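(* Let $G \in \mathscr{S}$ and let $H$ be a normal subgroup of $G$ (not necessarily closed). Suppose $H$ contains an infinite compact locally normal subgroup of $G$. Then $H$ contains an infinite commensurated compact locally normal subgroup of $G$. In particular, if every non-trivial normal subgroup of $G$ contains an infinite compact locally normal subgroup of $G$, then $G$ satisfies the following property (S1): every non-trivial normal subgroup of $G$ contains an infinite commensurated compact locally normal subgroup of $G$.
   Context: $\mathscr{S}$ is the class of non-discrete, compactly generated, topologically simple, totally disconnected locally compact groups (topologically simple: non-trivial, and the only closed normal subgroups are $\{1\}$ and the whole group). A subgroup of a topological group $G$ is locally normal in $G$ if its normaliser in $G$ is open. A subgroup $K \le G$ is commensurated (by $G$) if for every $g \in G$ the index $|K : K \cap gKg^{-1}|$ is finite. *)

theory Defs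
  imports
    "HOL-Analysis.Abstract_Topological_Spaces"
    "HOL-Algebra.Group_Action"
    "HOL-Algebra.Generated_Groups"
begin

locale topological_group = group G for G (structure) +
  fixes T :: "'a topology"
  assumes topspace_eq: "topspace T = carrier G"
    and continuous_mult: "continuous_map (prod_topology T T) T (\<lambda>(x, y). x \<otimes> y)"
    and continuous_inv: "continuous_map T T (\<lambda>x. inv x)"

definition totally_disconnected_space :: "'a topology \<Rightarrow> bool" where
  "totally_disconnected_space X \<longleftrightarrow> (\<forall>x \<in> topspace X. connected_component_of_set X x = {x})"

definition compactly_generated :: "('a, 'b) monoid_scheme \<Rightarrow> 'a topology \<Rightarrow> bool" where
  "compactly_generated G T \<longleftrightarrow> (\<exists>C. compactin T C \<and> generate G C = carrier G)"

definition topologically_simple :: "('a, 'b) monoid_scheme \<Rightarrow> 'a topology \<Rightarrow> bool" where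
  "topologically_simple G T \<longleftrightarrow>
     carrier G \<noteq> {\<one>\<^bsub>G\<^esub>} \<and>
     (\<forall>N. N \<lhd> G \<and> closedin T N \<longrightarrow> N = {\<one>\<^bsub>G\<^esub>} \<or> N = carrier G)"

text \<open>
  The Hausdorff condition is the usual convention for locally compact groups; here it is
  redundant, since a totally disconnected topological group is automatically Hausdorff.
\<close>
locale script_S = topological_group G T for G (structure) and T +
  assumes non_discrete: "T \<noteq> discrete_topology (carrier G)"
    and Hausdorff: "Hausdorff_space T"
    and locally_compact: "locally_compact_space T"
    and totally_disconnected: "totally_disconnected_space T"
    and compactly_generated: "compactly_generated G T"
    and topologically_simple: "topologically_simple G T"

definition locally_normal :: "('a, 'b) monoid_scheme \<Rightarrow> 'a topology \<Rightarrow> 'a set \<Rightarrow> bool" where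
  "locally_normal G T K \<longleftrightarrow> subgroup K G \<and> openin T (normalizer G K)"

text \<open>
  The index of a subgroup \<open>L\<close> of \<open>K\<close> is the number of cosets of \<open>L\<close> in the group
  \<open>G\<lparr>carrier := K\<rparr>\<close>; finiteness is stated for the set of cosets because \<^const>\<open>card\<close>
  of an infinite set is \<open>0\<close>.
\<close>
definition commensurated :: "('a, 'b) monoid_scheme \<Rightarrow> 'a set \<Rightarrow> bool" where
  "commensurated G K \<longleftrightarrow> subgroup K G \<and>
     (\<forall>g \<in> carrier G.
        finite (rcosets\<^bsub>G\<lparr>carrier := K\<rparr>\<^esub> (K \<inter> (g <#\<^bsub>G\<^esub> K #>\<^bsub>G\<^esub> inv\<^bsub>G\<^esub> g))))"

definition infinite_compact_locally_normal ::
    "('a, 'b) monoid_scheme \<Rightarrow> 'a topology \<Rightarrow> 'a set \<Rightarrow> bool" where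
  "infinite_compact_locally_normal G T K \<longleftrightarrow>
     infinite K \<and> compactin T K \<and> locally_normal G T K"

definition property_S1 :: "('a, 'b) monoid_scheme \<Rightarrow> 'a topology \<Rightarrow> bool" where
  "property_S1 G T \<longleftrightarrow>
     (\<forall>N. N \<lhd> G \<and> N \<noteq> {\<one>\<^bsub>G\<^esub>} \<longrightarrow>
        (\<exists>K \<subseteq> N. infinite_compact_locally_normal G T K \<and> commensurated G K))"

end

theory Submission
  imports Defs
begin

text \<open>
  Let \<open>K \<le> H\<close> be infinite, compact and locally normal. The normal closure \<open>D\<close> of \<open>K\<close> is dense, so
  \<open>G = D U\<close> for any compact open subgroup \<open>U\<close>, and compact generation yields finitely many conjugates
  of \<open>K\<close> that generate \<open>G\<close> together with \<open>U\<close>. As the normaliser of \<open>K\<close> is open and \<open>U\<close> is compact,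
  the \<open>U\<close>-conjugates of these form a finite family, and an open subgroup \<open>P \<le> U\<close>, itself normalised
  by \<open>U\<close>, normalises every member. The product \<open>L\<close> of the groups \<open>A \<inter> P\<close>, with \<open>A\<close> in the family, is
  a compact subgroup of \<open>H\<close> normalised by \<open>U\<close>. Every \<open>A\<close> is normalised by \<open>L\<close> and meets \<open>L\<close> in a
  subgroup of finite index, which forces \<open>A\<close> to commensurate \<open>L\<close>. Hence all of \<open>G\<close> commensurates \<open>L\<close>.
\<close>

section \<open>Conjugation and commensuration\<close>

context group
begin

section \<open>Elementary rules for conjugating elements and subsets\<close>

definition conjg :: "'a \<Rightarrow> 'a \<Rightarrow> 'a" where
  "conjg g x = g \<otimes> x \<otimes> inv g"

lemma conjg_set_eq: "g <# A #> inv g = conjg g ` A"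
  by (auto simp: conjg_def l_coset_def r_coset_def)

lemma conjg_closed [simp]: "g \<in> carrier G \<Longrightarrow> x \<in> carrier G \<Longrightarrow> conjg g x \<in> carrier G"
  by (simp add: conjg_def)

lemma conjg_one [simp]: "x \<in> carrier G \<Longrightarrow> conjg \<one> x = x"
  by (simp add: conjg_def)

lemma conjg_mult_left:
  "g \<in> carrier G \<Longrightarrow> h \<in> carrier G \<Longrightarrow> x \<in> carrier G \<Longrightarrow> conjg (g \<otimes> h) x = conjg g (conjg h x)"
  by (simp add: conjg_def inv_mult_group m_assoc)

lemma conjg_mult:
  assumes "g \<in> carrier G" "x \<in> carrier G" "y \<in> carrier G"
  shows "conjg g (x \<otimes> y) = conjg g x \<otimes> conjg g y"
  using assms by (simp add: conjg_def m_assoc inv_solve_left)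

lemma conjg_inv_conjg [simp]:
  "g \<in> carrier G \<Longrightarrow> x \<in> carrier G \<Longrightarrow> conjg (inv g) (conjg g x) = x"
  "g \<in> carrier G \<Longrightarrow> x \<in> carrier G \<Longrightarrow> conjg g (conjg (inv g) x) = x"
  by (simp_all flip: conjg_mult_left)

lemma conjg_hom: "g \<in> carrier G \<Longrightarrow> group_hom G G (conjg g)"
  by unfold_locales (auto simp: hom_def conjg_mult)

lemma subgroup_conjg: "g \<in> carrier G \<Longrightarrow> subgroup A G \<Longrightarrow> subgroup (conjg g ` A) G"
  by (rule group_hom.subgroup_img_is_subgroup[OF conjg_hom])

lemma conjg_image_carrier [simp]:
  "g \<in> carrier G \<Longrightarrow> A \<subseteq> carrier G \<Longrightarrow> conjg g ` A \<subseteq> carrier G"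
  by auto

lemma conjg_image_mult:
  assumes "g \<in> carrier G" "h \<in> carrier G" "A \<subseteq> carrier G"
  shows "conjg (g \<otimes> h) ` A = conjg g ` conjg h ` A"
  unfolding image_image by (rule image_cong) (use assms in \<open>auto simp: conjg_mult_left\<close>)

lemma conjg_image_one [simp]: "A \<subseteq> carrier G \<Longrightarrow> conjg \<one> ` A = A"
  by (force simp: image_iff)

lemma conjg_image_cancel:
  assumes "g \<in> carrier G" "A \<subseteq> carrier G"
  shows "conjg g ` conjg (inv g) ` A = A" "conjg (inv g) ` conjg g ` A = A"
  using assms by (simp_all flip: conjg_image_mult)

lemma conjg_image_eqI:
  assumes g: "g \<in> carrier G" "A \<subseteq> carrier G" "conjg g ` A \<subseteq> A" "conjg (inv g) ` A \<subseteq> A"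
  shows "conjg g ` A = A"
proof
  show "A \<subseteq> conjg g ` A"
  proof
    fix x assume x: "x \<in> A"
    then have "x = conjg g (conjg (inv g) x)"
      using g by auto
    with x g(4) show "x \<in> conjg g ` A" by blast
  qed
qed fact

lemma normalizer_eq: "A \<subseteq> carrier G \<Longrightarrow> normalizer G A = {g \<in> carrier G. conjg g ` A = A}"
  by (auto simp: normalizer_def stabilizer_def conjg_set_eq)

section \<open>Subgroups generated by unions\<close>

lemma conjg_image_generate_subset:
  assumes "g \<in> carrier G" "S \<subseteq> carrier G" "conjg g ` S \<subseteq> S"
  shows "conjg g ` generate G S \<subseteq> generate G S"
  using group_hom.generate_img[OF conjg_hom[OF assms(1)] assms(2)] mono_generate[OF assms(3)] by simp

text \<open>Moving \<open>b\<close> to the right past an element of \<open>A\<close> only replaces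
  that element by its conjugate under \<open>b\<close>, which stays in \<open>A\<close>; so the
  product set is closed under products and inverses. This description makes compactness of a
  generated subgroup accessible.\<close>

lemma set_mult_eq_generate:
  assumes A: "subgroup A G" and B: "subgroup B G"
    and norm: "\<And>b. b \<in> B \<Longrightarrow> conjg b ` A = A"
  shows "A <#> B = generate G (A \<union> B)"
proof
  interpret A: subgroup A G by fact
  interpret B: subgroup B G by fact
  show "A <#> B \<subseteq> generate G (A \<union> B)"
    by (auto simp: set_mult_def intro: generate.intros)
  have swap: "conjg b a \<in> A" if "b \<in> B" "a \<in> A" for a b
    using norm that by blast
  have "subgroup (A <#> B) G"
  proof
    show "A <#> B \<subseteq> carrier G"
      by (auto simp: set_mult_def)
    have "\<one> \<otimes> \<one> \<in> A <#> B"
      unfolding set_mult_def using A.one_closed B.one_closed by blast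
    then show "\<one> \<in> A <#> B" by simp
  next
    fix x y assume "x \<in> A <#> B" "y \<in> A <#> B"
    then obtain a b a' b' where ab: "a \<in> A" "b \<in> B" "x = a \<otimes> b" "a' \<in> A" "b' \<in> B" "y = a' \<otimes> b'"
      unfolding set_mult_def by blast
    then have "x \<otimes> y = (a \<otimes> conjg b a') \<otimes> (b \<otimes> b')"
      by (simp add: conjg_def m_assoc inv_solve_left)
    moreover have "a \<otimes> conjg b a' \<in> A" "b \<otimes> b' \<in> B"
      using ab swap[of b a'] by auto
    ultimately show "x \<otimes> y \<in> A <#> B"
      unfolding set_mult_def by blast
  next
    fix x assume "x \<in> A <#> B"
    then obtain a b where ab: "a \<in> A" "b \<in> B" "x = a \<otimes> b"
      unfolding set_mult_def by blast
    then have "inv x = conjg (inv b) (inv a) \<otimes> inv b"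
      by (simp add: conjg_def m_assoc inv_mult_group)
    moreover have "conjg (inv b) (inv a) \<in> A" "inv b \<in> B"
      using ab swap[of "inv b" "inv a"] by auto
    ultimately show "inv x \<in> A <#> B"
      unfolding set_mult_def by blast
  qed
  moreover have "A \<union> B \<subseteq> A <#> B"
  proof
    fix x assume "x \<in> A \<union> B"
    then have "x = x \<otimes> \<one> \<and> x \<in> A \<or> x = \<one> \<otimes> x \<and> x \<in> B" by auto
    then show "x \<in> A <#> B"
      unfolding set_mult_def using A.one_closed B.one_closed by blast
  qed
  ultimately show "generate G (A \<union> B) \<subseteq> A <#> B"
    by (rule generate_subgroup_incl[rotated])
qed

text \<open>A word has finitely many letters. This is what cuts the infinite family of all
  conjugates of K down to a finite one.\<close>

lemma generate_UN_finite:
  assumes "x \<in> generate G (\<Union>i\<in>J. f i)"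
  shows "\<exists>I. finite I \<and> I \<subseteq> J \<and> x \<in> generate G (\<Union>i\<in>I. f i)"
  using assms
proof (induction x rule: generate.induct)
  case one
  show ?case by (intro exI[of _ "{}"]) (auto intro: generate.one)
next
  case (incl h)
  then obtain i where "i \<in> J" "h \<in> f i" by blast
  then show ?case by (intro exI[of _ "{i}"]) (auto intro: generate.incl)
next
  case (inv h)
  then obtain i where "i \<in> J" "h \<in> f i" by blast
  then show ?case by (intro exI[of _ "{i}"]) (auto intro: generate.inv)
next
  case (eng h1 h2)
  then obtain I1 I2 where I: "finite I1" "I1 \<subseteq> J" "h1 \<in> generate G (\<Union>i\<in>I1. f i)"
    "finite I2" "I2 \<subseteq> J" "h2 \<in> generate G (\<Union>i\<in>I2. f i)" by blast
  then have "h1 \<in> generate G (\<Union>i\<in>I1 \<union> I2. f i)" "h2 \<in> generate G (\<Union>i\<in>I1 \<union> I2. f i)"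
    using mono_generate[of "\<Union>i\<in>I1. f i" "\<Union>i\<in>I1 \<union> I2. f i"]
      mono_generate[of "\<Union>i\<in>I2. f i" "\<Union>i\<in>I1 \<union> I2. f i"] by auto
  with I show ?case
    by (intro exI[of _ "I1 \<union> I2"]) (auto intro: generate.eng)
qed

text \<open>For subgroups, \<open>covered A B\<close> says that the index of \<open>A \<inter> B\<close> in \<open>A\<close> is finite.\<close>

definition covered :: "'a set \<Rightarrow> 'a set \<Rightarrow> bool" where
  "covered A B \<longleftrightarrow> (\<exists>F. finite F \<and> F \<subseteq> carrier G \<and> A \<subseteq> F <#> B)"

lemma covered_refl: "A \<subseteq> carrier G \<Longrightarrow> covered A A"
  unfolding covered_def by (intro exI[of _ "{\<one>}"]) (auto simp: set_mult_def subset_iff)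

lemma covered_trans:
  assumes "covered A B" "covered B C" "C \<subseteq> carrier G"
  shows "covered A C"
proof -
  obtain E F where E: "finite E" "E \<subseteq> carrier G" "A \<subseteq> E <#> B"
    and F: "finite F" "F \<subseteq> carrier G" "B \<subseteq> F <#> C"
    using assms(1,2) by (auto simp: covered_def)
  have "E <#> B \<subseteq> E <#> (F <#> C)"
    by (rule mono_set_mult) (use F(3) in auto)
  with E(3) have "A \<subseteq> (E <#> F) <#> C"
    using E(2) F(2) assms(3) by (simp add: set_mult_assoc)
  moreover have "finite (E <#> F)" "E <#> F \<subseteq> carrier G"
    using E F by (auto simp: set_mult_def)
  ultimately show ?thesis by (auto simp: covered_def)
qed

lemma covered_conjg:
  assumes "covered A B" "g \<in> carrier G" "B \<subseteq> carrier G"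
  shows "covered (conjg g ` A) (conjg g ` B)"
proof -
  obtain F where F: "finite F" "F \<subseteq> carrier G" "A \<subseteq> F <#> B"
    using assms(1) by (auto simp: covered_def)
  have "conjg g ` A \<subseteq> conjg g ` F <#> conjg g ` B"
  proof
    fix y assume "y \<in> conjg g ` A"
    then obtain f b where "f \<in> F" "b \<in> B" "y = conjg g (f \<otimes> b)"
      using F(3) by (auto simp: set_mult_def)
    moreover from this have "y = conjg g f \<otimes> conjg g b"
      using assms F(2) conjg_mult by blast
    ultimately show "y \<in> conjg g ` F <#> conjg g ` B" unfolding set_mult_def by blast
  qed
  then show ?thesis
    using F(1,2) assms(2) unfolding covered_def by (intro exI[of _ "conjg g ` F"]) auto
qed

text \<open>For a subgroup \<open>L\<close> this is the commensurator of \<open>L\<close>. Imposing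
  the condition on both \<open>g\<close> and \<open>inv g\<close> builds in closure under inverses
  and bounds the index of the intersection in both \<open>L\<close> and its conjugate.\<close>

definition virtual_normalizer :: "'a set \<Rightarrow> 'a set" where
  "virtual_normalizer L =
    {g \<in> carrier G. covered L (conjg g ` L) \<and> covered L (conjg (inv g) ` L)}"

text \<open>For products, conjugate the covering for \<open>h\<close> by \<open>g\<close> and chain
  it with the covering for \<open>g\<close>.\<close>

lemma virtual_normalizer_subgroup:
  assumes L: "L \<subseteq> carrier G"
  shows "subgroup (virtual_normalizer L) G"
proof
  have *: "covered L (conjg (g \<otimes> h) ` L)"
    if "g \<in> carrier G" "h \<in> carrier G" "covered L (conjg g ` L)" "covered L (conjg h ` L)" for g h
  proof (rule covered_trans[OF that(3)])
    show "covered (conjg g ` L) (conjg (g \<otimes> h) ` L)"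
      using covered_conjg[OF that(4,1)] that L by (force simp: conjg_image_mult)
    show "conjg (g \<otimes> h) ` L \<subseteq> carrier G" using that L by auto
  qed
  show "x \<otimes> y \<in> virtual_normalizer L"
    if "x \<in> virtual_normalizer L" "y \<in> virtual_normalizer L" for x y
    using that by (auto simp: virtual_normalizer_def inv_mult_group intro!: *)
  have "conjg \<one> ` L = L"
    using L by simp
  then show "\<one> \<in> virtual_normalizer L"
    using covered_refl[OF L] by (auto simp: virtual_normalizer_def)
qed (auto simp: virtual_normalizer_def)

text \<open>The covering uses left cosets with representatives anywhere in G, whereas the index
  counts right cosets inside \<open>L\<close>. Taking inverses exchanges the sides, and each element
  of the finite covering set accounts for at most one right coset.\<close>

lemma commensurated_if_virtual_normalizer:
  assumes L: "subgroup L G" and V: "carrier G \<subseteq> virtual_normalizer L"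
  shows "commensurated G L"
  unfolding commensurated_def
proof (intro conjI ballI L)
  interpret L: subgroup L G by fact
  fix g assume g: "g \<in> carrier G"
  let ?M = "conjg g ` L"
  interpret M: subgroup ?M G
    by (rule subgroup_conjg[OF g L])
  obtain F where F: "finite F" "F \<subseteq> carrier G" "L \<subseteq> F <#> ?M"
    using V g by (auto simp: virtual_normalizer_def covered_def)
  \<comment> \<open>Chooses an element of \<open>L\<close> whose inverse lies in the coset of
    \<open>f\<close>. The value is arbitrary if there is none, but it is used only for those
    \<open>f\<close> where some \<open>x\<close> provides one.\<close>
  define r where "r f = (SOME x. x \<in> L \<and> (\<exists>m\<in>?M. inv x = f \<otimes> m))" for f
  have "rcosets\<^bsub>G\<lparr>carrier := L\<rparr>\<^esub> (L \<inter> ?M) \<subseteq> (\<lambda>f. (L \<inter> ?M) #> r f) ` F"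
  proof
    fix C assume "C \<in> rcosets\<^bsub>G\<lparr>carrier := L\<rparr>\<^esub> (L \<inter> ?M)"
    then obtain x where x: "x \<in> L" "C = (L \<inter> ?M) #> x"
      by (auto simp: RCOSETS_def r_coset_def)
    have "inv x \<in> F <#> ?M"
      using F(3) L.m_inv_closed[OF x(1)] by blast
    then obtain f m where fm: "f \<in> F" "m \<in> ?M" "inv x = f \<otimes> m"
      unfolding set_mult_def by blast
    have "r f \<in> L \<and> (\<exists>m\<in>?M. inv (r f) = f \<otimes> m)"
      unfolding r_def by (rule someI[of _ x]) (use x fm in blast)
    then obtain m' where y: "r f \<in> L" "m' \<in> ?M" "inv (r f) = f \<otimes> m'" by blast
    have f: "f \<in> carrier G" "m \<in> carrier G" "m' \<in> carrier G" "x \<in> carrier G" "r f \<in> carrier G"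
      using fm F(2) M.subset y x by auto
    have "inv (inv (r f)) = inv m' \<otimes> inv f" using y(3) f by (simp add: inv_mult_group)
    then have "r f \<otimes> inv x = inv m' \<otimes> (inv f \<otimes> (f \<otimes> m))"
      using f fm(3) by (simp add: m_assoc)
    also have "\<dots> = inv m' \<otimes> m"
      using f by (simp flip: m_assoc)
    finally have "r f \<otimes> inv x \<in> ?M"
      using M.m_closed[OF M.m_inv_closed[OF y(2)] fm(2)] by simp
    moreover have "r f \<otimes> inv x \<in> L"
      using x(1) y(1) by simp
    ultimately have "r f \<otimes> inv x \<in> L \<inter> ?M" by blast
    moreover have "r f = (r f \<otimes> inv x) \<otimes> x"
      using f by (simp add: m_assoc)
    ultimately have "r f \<in> (L \<inter> ?M) #> x"
      unfolding r_coset_def by blast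
    then have "(L \<inter> ?M) #> r f = C"
      using x(2) repr_independence[OF _ f(4) subgroups_Inter_pair[OF L M.subgroup_axioms]] by simp
    with fm(1) show "C \<in> (\<lambda>f. (L \<inter> ?M) #> r f) ` F" by blast
  qed
  then show "finite (rcosets\<^bsub>G\<lparr>carrier := L\<rparr>\<^esub> (L \<inter> (g <# L #> inv g)))"
    using F(1) by (auto simp: conjg_set_eq intro: finite_subset)
qed

text \<open>
  Since \<open>a l a\<^sup>-\<^sup>1 = (a \<cdot> l a\<^sup>-\<^sup>1 l\<^sup>-\<^sup>1) l\<close> and \<open>l\<close> normalises \<open>A\<close>, the conjugate \<open>a L a\<^sup>-\<^sup>1\<close> lies
  in \<open>A L\<close>, which is a finite union of cosets of \<open>L\<close>.
\<close>

lemma virtual_normalizer_factor: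
  assumes A: "subgroup A G" and L: "subgroup L G"
    and norm: "\<And>l. l \<in> L \<Longrightarrow> conjg l ` A = A" and cov: "covered A L"
  shows "A \<subseteq> virtual_normalizer L"
proof
  interpret A: subgroup A G by fact
  interpret L: subgroup L G by fact
  obtain F where F: "finite F" "F \<subseteq> carrier G" "A \<subseteq> F <#> L"
    using cov by (auto simp: covered_def)
  have *: "covered (conjg a ` L) L" if a: "a \<in> A" for a
  proof -
    have "conjg a ` L \<subseteq> F <#> L"
    proof
      fix y assume "y \<in> conjg a ` L"
      then obtain l where l: "l \<in> L" "y = conjg a l" by auto
      have "conjg l (inv a) \<in> A" using norm[OF l(1)] A.m_inv_closed[OF a] by blast
      then have "a \<otimes> conjg l (inv a) \<in> A" using a by simp
      then obtain f l' where f: "f \<in> F" "l' \<in> L" "a \<otimes> conjg l (inv a) = f \<otimes> l'"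
        using F(3) by (auto simp: set_mult_def)
      have "y = (a \<otimes> conjg l (inv a)) \<otimes> l"
        using a l by (simp add: conjg_def m_assoc)
      also have "\<dots> = f \<otimes> (l' \<otimes> l)"
        using f l F(2) by (auto simp: m_assoc)
      finally show "y \<in> F <#> L" using f l by (auto simp: set_mult_def)
    qed
    then show ?thesis using F by (auto simp: covered_def)
  qed
  \<comment> \<open>Conjugating by \<open>a\<close> the covering obtained for \<open>inv a\<close>
    reverses its direction.\<close>
  have **: "covered L (conjg a ` L)" if a: "a \<in> A" for a
  proof -
    have "covered (conjg a ` conjg (inv a) ` L) (conjg a ` L)"
      by (rule covered_conjg[OF *]) (use a in auto)
    moreover have "conjg a ` conjg (inv a) ` L = L"
      using a by (simp add: conjg_image_cancel L.subset)
    ultimately show ?thesis by simp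
  qed
  show "a \<in> virtual_normalizer L" if "a \<in> A" for a
    using **[OF that] **[OF A.m_inv_closed[OF that]] that by (auto simp: virtual_normalizer_def)
qed

end

section \<open>Compact subgroups of topological groups\<close>

context topological_group
begin

section \<open>Open subgroups, coset coverings and closures\<close>

lemma openin_subset_carrier: "openin T S \<Longrightarrow> S \<subseteq> carrier G"
  using openin_subset[of T S] by (simp add: topspace_eq)

lemma compactin_subset_carrier: "compactin T S \<Longrightarrow> S \<subseteq> carrier G"
  using compactin_subset_topspace[of T S] by (simp add: topspace_eq)

lemma continuous_map_mult:
  assumes "continuous_map X T f" "continuous_map X T g"
  shows "continuous_map X T (\<lambda>x. f x \<otimes> g x)"
  using continuous_map_compose[OF _ continuous_mult, of X "\<lambda>x. (f x, g x)"] assms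
  by (simp add: continuous_map_paired o_def)

lemma continuous_map_conjg: "g \<in> carrier G \<Longrightarrow> continuous_map T T (conjg g)"
  unfolding conjg_def by (intro continuous_map_mult) (auto simp: topspace_eq)

lemma openin_conjg_image:
  assumes "openin T S" "g \<in> carrier G"
  shows "openin T (conjg g ` S)"
proof -
  have "conjg g ` S = {x \<in> topspace T. conjg (inv g) x \<in> S}"
  proof (intro Set.set_eqI iffI)
    fix x assume "x \<in> conjg g ` S"
    then show "x \<in> {x \<in> topspace T. conjg (inv g) x \<in> S}"
      using openin_subset_carrier[OF assms(1)] assms(2) by (auto simp: topspace_eq)
  next
    fix x assume "x \<in> {x \<in> topspace T. conjg (inv g) x \<in> S}"
    then have "conjg (inv g) x \<in> S" "x = conjg g (conjg (inv g) x)"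
      using assms(2) by (auto simp: topspace_eq)
    then show "x \<in> conjg g ` S" by blast
  qed
  then show ?thesis
    using openin_continuous_map_preimage[OF continuous_map_conjg assms(1)] assms(2) by simp
qed

lemma openin_left_translate:
  assumes "openin T S" "g \<in> carrier G"
  shows "openin T {x \<in> carrier G. inv g \<otimes> x \<in> S}"
  using openin_continuous_map_preimage[OF continuous_map_mult assms(1), of T "\<lambda>_. inv g" "\<lambda>x. x"] assms(2)
  by (simp add: topspace_eq)

text \<open>The left translate of \<open>W\<close> by a point \<open>h\<close> of \<open>H\<close>
  is an open neighbourhood of \<open>h\<close> inside \<open>H\<close>.\<close>

lemma openin_subgroupI:
  assumes H: "subgroup H G" and W: "openin T W" "\<one> \<in> W" "W \<subseteq> H"
  shows "openin T H"
proof (subst openin_subopen, intro ballI)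
  interpret H: subgroup H G by fact
  fix h assume h: "h \<in> H"
  have "x \<in> H" if "x \<in> carrier G" "inv h \<otimes> x \<in> W" for x
  proof -
    have "h \<otimes> (inv h \<otimes> x) \<in> H" using h that(2) W(3) by blast
    then show ?thesis using h that(1) by (simp flip: m_assoc)
  qed
  then show "\<exists>V. openin T V \<and> h \<in> V \<and> V \<subseteq> H"
    using openin_left_translate[OF W(1), of h] h W(2)
    by (intro exI[of _ "{x \<in> carrier G. inv h \<otimes> x \<in> W}"]) auto
qed

text \<open>The complement is a union of left cosets of \<open>H\<close>, which are open.\<close>

lemma closedin_open_subgroup:
  assumes H: "subgroup H G" "openin T H"
  shows "closedin T H"
  unfolding closedin_def
proof
  interpret H: subgroup H G by fact
  show "H \<subseteq> topspace T" using H.subset by (simp add: topspace_eq)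
  show "openin T (topspace T - H)"
  proof (subst openin_subopen, intro ballI)
    fix x assume x: "x \<in> topspace T - H"
    have "y \<notin> H" if "y \<in> carrier G" "inv x \<otimes> y \<in> H" for y
    proof
      assume "y \<in> H"
      then have "y \<otimes> inv (inv x \<otimes> y) \<in> H" using that by blast
      moreover have "y \<otimes> inv (inv x \<otimes> y) = x"
        using that x by (simp add: topspace_eq inv_mult_group flip: m_assoc)
      ultimately show False using x by simp
    qed
    then have "{y \<in> carrier G. inv x \<otimes> y \<in> H} \<subseteq> topspace T - H"
      unfolding topspace_eq by blast
    moreover have "openin T {y \<in> carrier G. inv x \<otimes> y \<in> H}" "x \<in> {y \<in> carrier G. inv x \<otimes> y \<in> H}"
      using openin_left_translate[OF H(2), of x] x by (simp_all add: topspace_eq)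
    ultimately show "\<exists>V. openin T V \<and> x \<in> V \<and> V \<subseteq> topspace T - H"
      by blast
  qed
qed

text \<open>The left cosets of \<open>N\<close> through points of \<open>C\<close> form an open
  cover of \<open>C\<close>. Representatives are kept in \<open>C\<close>: if \<open>C\<close> is a
  subgroup, the remaining factor in \<open>N\<close> then lies in \<open>C\<close> too.\<close>

lemma compactin_finite_cosets:
  assumes C: "compactin T C" and N: "subgroup N G" "openin T N"
  shows "\<exists>F. finite F \<and> F \<subseteq> C \<and> C \<subseteq> F <#> N"
proof -
  interpret N: subgroup N G by fact
  define c where "c x = {y \<in> carrier G. inv x \<otimes> y \<in> N}" for x
  have car: "C \<subseteq> carrier G" by (rule compactin_subset_carrier[OF C])
  have "\<exists>\<F>. finite \<F> \<and> \<F> \<subseteq> c ` C \<and> C \<subseteq> \<Union>\<F>"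
  proof (rule compactinD[OF C])
    show "openin T V" if "V \<in> c ` C" for V
      using that car openin_left_translate[OF N(2)] by (auto simp: c_def)
    show "C \<subseteq> \<Union>(c ` C)"
      using car by (auto simp: c_def subset_iff intro!: bexI)
  qed
  then obtain F where F: "finite F" "F \<subseteq> C" "C \<subseteq> \<Union>(c ` F)"
    by (metis finite_subset_image)
  have "C \<subseteq> F <#> N"
  proof
    fix y assume y: "y \<in> C"
    then obtain x where x: "x \<in> F" "inv x \<otimes> y \<in> N"
      using F(3) by (auto simp: c_def)
    moreover have "y = x \<otimes> (inv x \<otimes> y)"
      using x(1) y F(2) car by (auto simp: subset_iff simp flip: m_assoc)
    ultimately show "y \<in> F <#> N" unfolding set_mult_def by blast
  qed
  with F show ?thesis by blast
qed

text \<open>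
  Van Dantzig's theorem: the left stabiliser of a compact open neighbourhood \<open>A\<close> of \<open>\<one>\<close> is an open
  subgroup contained in \<open>A\<close>.
\<close>

lemma compact_open_subgroup_exists:
  assumes "locally_compact_space T" "Hausdorff_space T" "totally_disconnected_space T"
    and N: "openin T N" "\<one> \<in> N"
  shows "\<exists>U. subgroup U G \<and> openin T U \<and> compactin T U \<and> U \<subseteq> N"
proof -
  obtain W C where WC: "openin T W" "compactin T C" "\<one> \<in> W" "W \<subseteq> C"
    using assms(1) one_closed unfolding locally_compact_space_def topspace_eq by blast
  have comp: "connected_component_of_set T \<one> = {\<one>}"
    using assms(3) by (simp add: totally_disconnected_space_def topspace_eq)
  have "{\<one>} \<in> connected_components_of T"
    unfolding connected_components_of_def by (rule image_eqI[of _ _ \<one>]) (simp_all add: comp topspace_eq)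
  \<comment> \<open>In a locally compact Hausdorff space a compact component has clopen
    neighbourhoods inside any open set around it; here the component is the single point
    \<open>\<one>\<close>.\<close>
  then obtain A B where A: "openin T A" "openin T B" "disjnt A B" "A \<union> B = topspace T"
      "{\<one>} \<subseteq> A" "A \<subseteq> W \<inter> N"
    by (rule wilder_locally_compact_component_thm[OF assms(1,2), of "{\<one>}" "W \<inter> N"])
      (use WC N in \<open>auto simp: topspace_eq\<close>)
  have "A = topspace T - B"
    using A(3,4) by (auto simp: disjnt_iff)
  then have "closedin T A" using A(2) by blast
  then have compA: "compactin T A"
    using closed_compactin[OF WC(2)] A(6) WC(4) by blast
  have Acar: "A \<subseteq> carrier G" by (rule openin_subset_carrier[OF A(1)])
  define U where "U = {g \<in> carrier G. \<forall>a\<in>A. g \<otimes> a \<in> A \<and> inv g \<otimes> a \<in> A}"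
  have U: "subgroup U G"
  proof
    show "U \<subseteq> carrier G" "\<one> \<in> U" using Acar by (auto simp: U_def)
    show "x \<otimes> y \<in> U" if "x \<in> U" "y \<in> U" for x y
      using that Acar by (auto simp: U_def m_assoc inv_mult_group subset_iff)
    show "inv x \<in> U" if "x \<in> U" for x
      using that by (auto simp: U_def)
  qed
  \<comment> \<open>The tube lemma for this open set, which contains
    \<open>{\<one>} \<times> A\<close>, yields a neighbourhood V of \<open>\<one>\<close> with V A
    inside A. Intersecting V with its inverse then gives a neighbourhood inside U.\<close>
  define P where "P = {z \<in> topspace (prod_topology T T). (case z of (x, y) \<Rightarrow> x \<otimes> y) \<in> A}"
  have "openin (prod_topology T T) P"
    unfolding P_def by (rule openin_continuous_map_preimage[OF continuous_mult A(1)])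
  moreover have "{\<one>} \<times> A \<subseteq> P"
    using Acar by (auto simp: P_def topspace_eq)
  ultimately obtain V V' where V: "openin T V" "\<one> \<in> V" "A \<subseteq> V'" "V \<times> V' \<subseteq> P"
    using tube_lemma_right[OF _ compA, of T P \<one>] by (auto simp: topspace_eq)
  have left: "x \<otimes> a \<in> A" if "x \<in> V" "a \<in> A" for x a
  proof -
    have "(x, a) \<in> P" using V(3,4) that by blast
    then show ?thesis by (simp add: P_def)
  qed
  have "openin T (V \<inter> {x \<in> topspace T. inv x \<in> V})"
    using V(1) openin_continuous_map_preimage[OF continuous_inv V(1)] by auto
  moreover have "\<one> \<in> V \<inter> {x \<in> topspace T. inv x \<in> V}"
    using V(2) by (simp add: topspace_eq)
  moreover have "V \<inter> {x \<in> topspace T. inv x \<in> V} \<subseteq> U"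
    using left by (auto simp: U_def topspace_eq)
  ultimately have openU: "openin T U"
    by (rule openin_subgroupI[OF U])
  have "U \<subseteq> A"
  proof
    fix g assume "g \<in> U"
    then have "g \<otimes> \<one> \<in> A" "g \<in> carrier G" using A(5) unfolding U_def by blast+
    then show "g \<in> A" by simp
  qed
  moreover have "compactin T U"
    using closed_compactin[OF compA] closedin_open_subgroup[OF U openU] \<open>U \<subseteq> A\<close> by blast
  ultimately show ?thesis using U openU A(6) by blast
qed

text \<open>Continuous maps that preserve \<open>N\<close> preserve its closure; multiplication is
  treated through the closure of \<open>N \<times> N\<close>, which is the product of the
  closures.\<close>

lemma normal_closure_of:
  assumes N: "N \<lhd> G"
  shows "T closure_of N \<lhd> G"
proof -
  interpret N: normal N G by fact
  let ?M = "T closure_of N"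
  have sub: "N \<subseteq> ?M"
    using closure_of_subset[of N T] N.subset by (simp add: topspace_eq)
  have car: "?M \<subseteq> carrier G"
    using closure_of_subset_topspace[of T N] by (simp add: topspace_eq)
  have maps: "f x \<in> ?M" if "continuous_map T T f" "f ` N \<subseteq> N" "x \<in> ?M" for f x
    using continuous_map_image_closure_subset[OF that(1), of N] closure_of_mono[OF that(2), of T] that(3) by blast
  have "x \<otimes> y \<in> ?M" if "x \<in> ?M" "y \<in> ?M" for x y
  proof -
    let ?m = "\<lambda>(x, y). x \<otimes> y"
    have "?m ` (?M \<times> ?M) \<subseteq> T closure_of (?m ` (N \<times> N))"
      using continuous_map_image_closure_subset[OF continuous_mult] by (simp add: closure_of_Times[symmetric])
    also have "\<dots> \<subseteq> ?M"
      by (rule closure_of_mono) auto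
    finally show ?thesis using that by auto
  qed
  moreover have "inv x \<in> ?M" if "x \<in> ?M" for x
    by (rule maps[OF continuous_inv _ that]) auto
  ultimately have "subgroup ?M G"
    using sub car by unfold_locales auto
  moreover have "g \<otimes> x \<otimes> inv g \<in> ?M" if "g \<in> carrier G" "x \<in> ?M" for g x
    using maps[OF continuous_map_conjg[OF that(1)] _ that(2)] that(1) N.inv_op_closed2
    by (auto simp: conjg_def)
  ultimately show ?thesis by (simp add: normal_inv_iff)
qed

section \<open>Compact products and conjugates of locally normal subgroups\<close>

lemma compactin_set_mult:
  assumes "compactin T A" "compactin T B"
  shows "compactin T (A <#> B)"
proof -
  have "compactin (prod_topology T T) (A \<times> B)" by (simp add: compactin_Times assms)
  then have "compactin T ((\<lambda>(x, y). x \<otimes> y) ` (A \<times> B))"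
    by (rule image_compactin[OF _ continuous_mult])
  moreover have "(\<lambda>(x, y). x \<otimes> y) ` (A \<times> B) = A <#> B"
    by (auto simp: set_mult_def)
  ultimately show ?thesis by simp
qed

text \<open>Add one subgroup at a time. What the others generate stays inside \<open>P\<close>,
  hence normalises the new \<open>A\<close>, so the enlarged group is a product of two compact
  sets.\<close>

lemma compactin_generate_Union:
  assumes "finite \<A>" and P: "subgroup P G"
    and "\<And>A. A \<in> \<A> \<Longrightarrow> subgroup A G \<and> compactin T A \<and> A \<subseteq> P"
    and "\<And>A p. A \<in> \<A> \<Longrightarrow> p \<in> P \<Longrightarrow> conjg p ` A = A"
  shows "compactin T (generate G (\<Union>\<A>))"
  using assms(1,3,4)
proof (induction \<A> rule: finite_induct)
  case empty
  then show ?case by (simp add: generate_empty finite_imp_compactin topspace_eq)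
next
  case (insert A \<A>)
  let ?M = "generate G (\<Union>\<A>)"
  have sub: "\<Union>\<A> \<subseteq> P" using insert.prems(1) by blast
  then have M: "subgroup ?M G"
    by (intro generate_is_subgroup) (use subgroup.subset[OF P] in blast)
  have MP: "?M \<subseteq> P" by (rule generate_subgroup_incl[OF sub P])
  have A: "subgroup A G" "compactin T A" using insert.prems(1) by auto
  have eq: "A <#> ?M = generate G (A \<union> ?M)"
    using set_mult_eq_generate[OF A(1) M] insert.prems(2) MP by blast
  have "generate G (A \<union> ?M) = generate G (\<Union>(insert A \<A>))"
  proof
    have "subgroup (generate G (\<Union>(insert A \<A>))) G"
      using sub insert.prems(1) subgroup.subset[OF P] by (intro generate_is_subgroup) blast
    moreover have "A \<union> ?M \<subseteq> generate G (\<Union>(insert A \<A>))"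
      using mono_generate[of "\<Union>\<A>" "\<Union>(insert A \<A>)"] by (auto intro: generate.incl)
    ultimately show "generate G (A \<union> ?M) \<subseteq> generate G (\<Union>(insert A \<A>))"
      by (rule generate_subgroup_incl[rotated])
    show "generate G (\<Union>(insert A \<A>)) \<subseteq> generate G (A \<union> ?M)"
      by (rule mono_generate) (auto intro: generate.incl)
  qed
  moreover have "compactin T (A <#> ?M)"
    using insert.prems by (intro compactin_set_mult A insert.IH) auto
  ultimately show ?case by (simp add: eq)
qed

text \<open>It contains the conjugate by \<open>g\<close> of the normaliser of \<open>K\<close>, an
  open set around \<open>\<one>\<close>.\<close>

lemma openin_normalizer_conjg:
  assumes K: "K \<subseteq> carrier G" "openin T (normalizer G K)" and g: "g \<in> carrier G"
  shows "openin T (normalizer G (conjg g ` K))"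
proof (rule openin_subgroupI)
  have gK: "conjg g ` K \<subseteq> carrier G" using K(1) g by auto
  show "subgroup (normalizer G (conjg g ` K)) G" by (rule normalizer_imp_subgroup[OF gK])
  show "openin T (conjg g ` normalizer G K)"
    by (rule openin_conjg_image[OF K(2) g])
  show "\<one> \<in> conjg g ` normalizer G K"
    using subgroup.one_closed[OF normalizer_imp_subgroup[OF K(1)]] g
    by (intro image_eqI[of _ _ \<one>]) (auto simp: conjg_def)
  show "conjg g ` normalizer G K \<subseteq> normalizer G (conjg g ` K)"
  proof
    fix x assume "x \<in> conjg g ` normalizer G K"
    then obtain n where n: "n \<in> carrier G" "conjg n ` K = K" "x = conjg g n"
      by (auto simp: normalizer_eq K(1))
    have "conjg x ` conjg g ` K = conjg (x \<otimes> g) ` K"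
      using n g K(1) by (simp add: conjg_image_mult)
    also have "x \<otimes> g = g \<otimes> n"
      using n g by (simp add: conjg_def m_assoc)
    also have "conjg (g \<otimes> n) ` K = conjg g ` K"
      using n g K(1) by (simp add: conjg_image_mult)
    finally show "x \<in> normalizer G (conjg g ` K)"
      using n g by (simp add: normalizer_eq[OF gK])
  qed
qed

text \<open>The conjugate of \<open>K\<close> by \<open>g\<close> depends only on the left coset of
  \<open>g\<close> modulo the normaliser, and finitely many such cosets cover
  \<open>C\<close>.\<close>

lemma finite_conjugates:
  assumes K: "K \<subseteq> carrier G" "openin T (normalizer G K)" and C: "compactin T C"
  shows "finite ((\<lambda>g. conjg g ` K) ` C)"
proof -
  obtain F where F: "finite F" "F \<subseteq> C" "C \<subseteq> F <#> normalizer G K"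
    using compactin_finite_cosets[OF C normalizer_imp_subgroup[OF K(1)] K(2)] by blast
  have "(\<lambda>g. conjg g ` K) ` C \<subseteq> (\<lambda>g. conjg g ` K) ` F"
  proof
    fix A assume "A \<in> (\<lambda>g. conjg g ` K) ` C"
    then obtain f n where f: "f \<in> F" "n \<in> normalizer G K" "A = conjg (f \<otimes> n) ` K"
      using F(3) unfolding set_mult_def by blast
    moreover have "f \<in> carrier G"
      using f(1) F(2) compactin_subset_carrier[OF C] by blast
    ultimately have "A = conjg f ` K"
      using K(1) by (simp add: conjg_image_mult normalizer_eq)
    with f(1) show "A \<in> (\<lambda>g. conjg g ` K) ` F" by blast
  qed
  then show ?thesis using F(1) by (meson finite_imageI finite_subset)
qed

end

section \<open>Commensurated subgroups of dense normal subgroups\<close>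

context script_S
begin

text \<open>The closure of \<open>N\<close> is a non-trivial closed normal subgroup, so topological
  simplicity makes it the whole group.\<close>

lemma normal_subgroup_dense:
  assumes N: "N \<lhd> G" "N \<noteq> {\<one>}" and W: "openin T W" "W \<noteq> {}"
  shows "N \<inter> W \<noteq> {}"
proof -
  interpret N: normal N G by fact
  have sub: "N \<subseteq> T closure_of N"
    using closure_of_subset[of N T] N.subset by (simp add: topspace_eq)
  then have "T closure_of N \<noteq> {\<one>}"
    using N(2) N.one_closed by blast
  then have "T closure_of N = carrier G"
    using topologically_simple normal_closure_of[OF N(1)] by (auto simp: topologically_simple_def)
  moreover obtain w where "w \<in> W" "w \<in> carrier G"
    using W openin_subset_carrier by blast
  ultimately have "w \<in> T closure_of N" by blast
  with \<open>w \<in> W\<close> W(1) show ?thesis by (auto simp: in_closure_of)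
qed

text \<open>A compact generating set lies in F U with F finite. By density each f in F agrees modulo
  \<open>U\<close> with an element of the normal closure of \<open>K\<close>, and that element
  involves only finitely many conjugates.\<close>

lemma generated_by_finitely_many_conjugates:
  assumes K: "subgroup K G" "infinite K" and U: "subgroup U G" "openin T U"
  shows "\<exists>I. finite I \<and> I \<subseteq> carrier G \<and>
    generate G (U \<union> (\<Union>i\<in>I. conjg i ` K)) = carrier G"
proof -
  interpret U: subgroup U G by fact
  interpret K: subgroup K G by fact
  let ?D = "generate G (\<Union>g\<in>carrier G. conjg g ` K)"
  have "?D \<lhd> G"
  proof (rule normal_generateI)
    show "(\<Union>g\<in>carrier G. conjg g ` K) \<subseteq> carrier G" by auto
    fix h g assume "h \<in> (\<Union>g\<in>carrier G. conjg g ` K)" and g: "g \<in> carrier G"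
    then obtain g' k where h: "g' \<in> carrier G" "k \<in> K" "h = conjg g' k" by auto
    then have "g \<otimes> h \<otimes> inv g = conjg (g \<otimes> g') k"
      using g by (simp add: conjg_mult_left) (simp add: conjg_def)
    with g h show "g \<otimes> h \<otimes> inv g \<in> (\<Union>g\<in>carrier G. conjg g ` K)" by blast
  qed
  moreover have "?D \<noteq> {\<one>}"
  proof
    assume D: "?D = {\<one>}"
    have "conjg \<one> ` K \<subseteq> ?D" by (rule subsetI, rule generate.incl) blast
    then have "K \<subseteq> {\<one>}" using D by (simp add: K.subset)
    then show False using K(2) finite_subset by blast
  qed
  ultimately have dense: "?D \<inter> W \<noteq> {}" if "openin T W" "W \<noteq> {}" for W
    using normal_subgroup_dense that by blast
  obtain C where C: "compactin T C" "generate G C = carrier G"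
    using compactly_generated by (auto simp: compactly_generated_def)
  obtain F where F: "finite F" "F \<subseteq> C" "C \<subseteq> F <#> U"
    using compactin_finite_cosets[OF C(1) U] by blast
  have Fcar: "F \<subseteq> carrier G" using F(2) compactin_subset_carrier[OF C(1)] by blast
  have "\<exists>I. finite I \<and> I \<subseteq> carrier G \<and>
      (\<exists>d \<in> generate G (\<Union>i\<in>I. conjg i ` K). inv f \<otimes> d \<in> U)" if "f \<in> F" for f
  proof -
    have f: "f \<in> carrier G" using that Fcar by blast
    have "openin T {x \<in> carrier G. inv f \<otimes> x \<in> U}"
      by (rule openin_left_translate[OF U(2) f])
    moreover have "f \<in> {x \<in> carrier G. inv f \<otimes> x \<in> U}"
      using f by simp
    ultimately obtain d where d: "d \<in> ?D" "inv f \<otimes> d \<in> U" using dense by blast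
    then show ?thesis using generate_UN_finite[OF d(1)] by blast
  qed
  then obtain I where I: "\<And>f. f \<in> F \<Longrightarrow> finite (I f) \<and> I f \<subseteq> carrier G \<and>
      (\<exists>d \<in> generate G (\<Union>i\<in>I f. conjg i ` K). inv f \<otimes> d \<in> U)"
    by metis
  define J where "J = \<Union>(I ` F)"
  let ?E = "U \<union> (\<Union>i\<in>J. conjg i ` K)"
  have J: "finite J" "J \<subseteq> carrier G"
    using I F(1) by (auto simp: J_def)
  have Ecar: "?E \<subseteq> carrier G" using J(2) by auto
  interpret E: subgroup "generate G ?E" G by (rule generate_is_subgroup[OF Ecar])
  have UE: "U \<subseteq> generate G ?E" by (auto intro: generate.incl)
  have "F \<subseteq> generate G ?E"
  proof
    fix f assume f: "f \<in> F"
    then obtain d where d: "d \<in> generate G (\<Union>i\<in>I f. conjg i ` K)" "inv f \<otimes> d \<in> U"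
      using I by blast
    have "generate G (\<Union>i\<in>I f. conjg i ` K) \<subseteq> generate G ?E"
      by (rule mono_generate) (use f in \<open>auto simp: J_def\<close>)
    then have dE: "d \<in> generate G ?E" using d(1) by blast
    \<comment> \<open>This writes \<open>f\<close> as a product of \<open>d\<close> and an element
      of \<open>U\<close>.\<close>
    have "d \<otimes> inv (inv f \<otimes> d) = f"
      using f Fcar E.mem_carrier[OF dE] by (auto simp: inv_mult_group subset_iff simp flip: m_assoc)
    moreover have "d \<otimes> inv (inv f \<otimes> d) \<in> generate G ?E"
      using dE d(2) UE by blast
    ultimately show "f \<in> generate G ?E" by simp
  qed
  then have "F <#> U \<subseteq> generate G ?E"
    using UE by (auto simp: set_mult_def)
  then have "generate G C \<subseteq> generate G ?E"
    using F(3) by (intro generate_subgroup_incl E.subgroup_axioms) blast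
  then show ?thesis using C(2) J E.subset by blast
qed

proposition commensurated_in_normal_subgroup:
  assumes H: "H \<lhd> G" and K: "K \<subseteq> H" "infinite_compact_locally_normal G T K"
  shows "\<exists>L \<subseteq> H. infinite_compact_locally_normal G T L \<and> commensurated G L"
proof -
  interpret H: normal H G by fact
  have K: "K \<subseteq> H" "infinite K" "compactin T K" "subgroup K G" "openin T (normalizer G K)"
    using K by (auto simp: infinite_compact_locally_normal_def locally_normal_def)
  have Kcar: "K \<subseteq> carrier G" by (rule subgroup.subset[OF K(4)])
  have "\<exists>U. subgroup U G \<and> openin T U \<and> compactin T U \<and> U \<subseteq> topspace T"
    by (rule compact_open_subgroup_exists[OF locally_compact Hausdorff totally_disconnected openin_topspace])
      (simp add: topspace_eq)
  then obtain U where U: "subgroup U G" "openin T U" "compactin T U"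
    by blast
  interpret U: subgroup U G by fact
  obtain I where I: "finite I" "I \<subseteq> carrier G"
      "generate G (U \<union> (\<Union>i\<in>I. conjg i ` K)) = carrier G"
    using generated_by_finitely_many_conjugates[OF K(4,2) U(1,2)] by (elim exE conjE)
  \<comment> \<open>Including \<open>\<one>\<close> puts \<open>K\<close> itself into the family,
    which later makes \<open>L\<close> infinite.\<close>
  define J where "J = insert \<one> I"
  have J: "finite J" "J \<subseteq> carrier G" "\<one> \<in> J" "I \<subseteq> J"
    using I(1,2) by (auto simp: J_def)
  define \<K> where "\<K> = {A. \<exists>u\<in>U. \<exists>i\<in>J. A = conjg (u \<otimes> i) ` K}"
  have \<K>_iff: "A \<in> \<K> \<longleftrightarrow> (\<exists>u\<in>U. \<exists>i\<in>J. A = conjg (u \<otimes> i) ` K)" for A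
    by (simp only: \<K>_def mem_Collect_eq)
  have Icar: "i \<in> carrier G" if "i \<in> J" for i using that J(2) by blast
  have \<K>E: "\<exists>g \<in> carrier G. A = conjg g ` K" if "A \<in> \<K>" for A
  proof -
    obtain u i where "u \<in> U" "i \<in> J" "A = conjg (u \<otimes> i) ` K"
      using \<open>A \<in> \<K>\<close> unfolding \<K>_iff by (elim bexE)
    then show ?thesis using Icar by (intro bexI[of _ "u \<otimes> i"]) auto
  qed
  have finK: "finite \<K>"
  proof (rule finite_subset)
    show "\<K> \<subseteq> (\<Union>i\<in>J. (\<lambda>g. conjg g ` K) ` (\<lambda>u. u \<otimes> i) ` U)"
    proof
      fix A assume "A \<in> \<K>"
      then obtain u i where "u \<in> U" "i \<in> J" "A = conjg (u \<otimes> i) ` K"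
        unfolding \<K>_iff by (elim bexE)
      then show "A \<in> (\<Union>i\<in>J. (\<lambda>g. conjg g ` K) ` (\<lambda>u. u \<otimes> i) ` U)"
        by (intro UN_I[of i] image_eqI[of _ _ "u \<otimes> i"] imageI)
    qed
    \<comment> \<open>For fixed \<open>i\<close> the translate of \<open>U\<close> by
      \<open>i\<close> is compact, so it produces only finitely many conjugates of
      \<open>K\<close>.\<close>
    have "finite ((\<lambda>g. conjg g ` K) ` (\<lambda>u. u \<otimes> i) ` U)" if "i \<in> J" for i
    proof -
      have "continuous_map T T (\<lambda>u. u \<otimes> i)"
        using Icar[OF that] by (intro continuous_map_mult) (auto simp: topspace_eq)
      then show ?thesis
        by (intro finite_conjugates Kcar K(5) image_compactin[OF U(3)])
    qed
    then show "finite (\<Union>i\<in>J. (\<lambda>g. conjg g ` K) ` (\<lambda>u. u \<otimes> i) ` U)"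
      using J(1) by (intro finite_UN_I)
  qed
  have \<K>I: "conjg i ` K \<in> \<K>" if "i \<in> J" for i
  proof -
    have "i = \<one> \<otimes> i" using Icar[OF that] by simp
    then have "conjg i ` K = conjg (\<one> \<otimes> i) ` K" by (rule arg_cong)
    then show ?thesis using that U.one_closed unfolding \<K>_iff by (intro bexI)
  qed
  have \<K>U: "conjg u ` A \<in> \<K>" if uA: "u \<in> U" "A \<in> \<K>" for u A
  proof -
    obtain i v where iv: "i \<in> J" "v \<in> U" "A = conjg (v \<otimes> i) ` K"
      using uA(2) unfolding \<K>_iff by (elim bexE)
    have "conjg u ` A = conjg (u \<otimes> v \<otimes> i) ` K"
      using uA(1) iv Icar[OF iv(1)] Kcar by (simp add: conjg_image_mult)
    moreover have "u \<otimes> v \<in> U" using uA(1) iv(2) by simp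
    ultimately show ?thesis using iv(1) unfolding \<K>_iff by (intro bexI)
  qed
  have \<K>sub: "subgroup A G" if "A \<in> \<K>" for A
    using \<K>E[OF that] subgroup_conjg K(4) by blast
  have \<K>car: "A \<subseteq> carrier G" if "A \<in> \<K>" for A
    by (rule subgroup.subset[OF \<K>sub[OF that]])
  have \<K>comp: "compactin T A" if "A \<in> \<K>" for A
    using \<K>E[OF that] image_compactin[OF K(3) continuous_map_conjg] by blast
  have \<K>H: "A \<subseteq> H" if "A \<in> \<K>" for A
    using \<K>E[OF that] K(1) H.inv_op_closed2 by (auto simp: conjg_def)
  have \<K>norm: "openin T (normalizer G A)" if "A \<in> \<K>" for A
    using \<K>E[OF that] openin_normalizer_conjg[OF Kcar K(5)] by blast
  define P where "P = {p \<in> U. \<forall>A\<in>\<K>. conjg p ` A = A}"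
  \<comment> \<open>Intersecting with the whole space gives the form in which a finite intersection
    of open sets is open even for an empty family.\<close>
  have P_eq: "P = U \<inter> ((\<Inter>A\<in>\<K>. normalizer G A) \<inter> topspace T)"
    unfolding P_def topspace_eq by (auto simp: normalizer_eq \<K>car cong: INF_cong)
  have openP: "openin T P"
    unfolding P_eq by (intro openin_Int U(2) openin_INT finK \<K>norm)
  have subP: "subgroup P G"
  proof
    show "P \<subseteq> carrier G" by (auto simp: P_def)
    show "\<one> \<in> P" using \<K>car by (auto simp: P_def)
    show "x \<otimes> y \<in> P" if "x \<in> P" "y \<in> P" for x y
      using that \<K>car by (auto simp: P_def conjg_image_mult)
    show "inv x \<in> P" if x: "x \<in> P" for x
    proof -
      have "conjg (inv x) ` A = A" if "A \<in> \<K>" for A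
        using conjg_image_cancel(2)[of x A] x \<K>car that by (auto simp: P_def)
      with x show ?thesis by (auto simp: P_def)
    qed
  qed
  interpret P: subgroup P G by fact
  \<comment> \<open>\<open>U\<close> permutes the family: how the conjugate of \<open>p\<close> by
    \<open>u\<close> acts on \<open>A\<close> is determined by how \<open>p\<close> acts on the
    conjugate of \<open>A\<close> by \<open>inv u\<close>, again a member, which \<open>p\<close>
    fixes.\<close>
  have PU: "conjg u p \<in> P" if up: "u \<in> U" "p \<in> P" for u p
  proof -
    have "p \<in> U" using up(2) by (simp add: P_def)
    have "conjg (conjg u p) ` A = A" if A: "A \<in> \<K>" for A
    proof -
      have "conjg (conjg u p) ` A = conjg u ` conjg p ` conjg (inv u) ` A"
        using up \<K>car[OF A] by (subst conjg_def) (simp add: conjg_image_mult P_def)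
      also have "conjg p ` conjg (inv u) ` A = conjg (inv u) ` A"
        using up(2) \<K>U[OF U.m_inv_closed[OF up(1)] A] by (simp add: P_def)
      finally show ?thesis
        using up(1) \<K>car[OF A] by (simp add: conjg_image_cancel)
    qed
    moreover have "conjg u p \<in> U" using up(1) \<open>p \<in> U\<close> by (simp add: conjg_def)
    ultimately show ?thesis by (simp add: P_def)
  qed
  define L where "L = generate G (\<Union>A\<in>\<K>. A \<inter> P)"
  have gen: "(\<Union>A\<in>\<K>. A \<inter> P) \<subseteq> carrier G" by auto
  have subL: "subgroup L G"
    unfolding L_def by (rule generate_is_subgroup[OF gen])
  interpret L: subgroup L G by fact
  have LH: "L \<subseteq> H"
    unfolding L_def using \<K>H by (intro generate_subgroup_incl H.subgroup_axioms) blast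
  have LP: "L \<subseteq> P"
    unfolding L_def by (intro generate_subgroup_incl subP) blast
  have AL: "A \<inter> P \<subseteq> L" if "A \<in> \<K>" for A
    using that unfolding L_def by (auto intro: generate.incl)
  have norm_piece: "conjg p ` (A \<inter> P) = A \<inter> P" if Ap: "A \<in> \<K>" "p \<in> P" for A p
  proof (rule conjg_image_eqI)
    have sub: "conjg q ` (A \<inter> P) \<subseteq> A \<inter> P" if "q \<in> P" for q
    proof -
      have "conjg q ` A = A" using that Ap(1) by (simp add: P_def)
      then show ?thesis using that by (auto simp: conjg_def)
    qed
    show "conjg p ` (A \<inter> P) \<subseteq> A \<inter> P" "conjg (inv p) ` (A \<inter> P) \<subseteq> A \<inter> P"
      using Ap(2) by (intro sub P.m_inv_closed; assumption)+
  qed (use Ap in auto)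
  have compL: "compactin T L"
    unfolding L_def
  proof (rule compactin_generate_Union[OF _ subP])
    show "finite ((\<lambda>A. A \<inter> P) ` \<K>)" using finK by simp
    show "subgroup B G \<and> compactin T B \<and> B \<subseteq> P" if "B \<in> (\<lambda>A. A \<inter> P) ` \<K>" for B
      using that \<K>sub \<K>comp closed_Int_compactin[OF closedin_open_subgroup[OF subP openP]]
        subgroups_Inter_pair[OF _ subP] by (auto simp: Int_commute)
    show "conjg p ` B = B" if "B \<in> (\<lambda>A. A \<inter> P) ` \<K>" "p \<in> P" for B p
      using that norm_piece by blast
  qed
  \<comment> \<open>Conjugation by \<open>u\<close> preserves \<open>P\<close> and permutes the
    family, hence permutes the generating pieces \<open>A \<inter> P\<close>.\<close>
  have UL_sub: "conjg u ` L \<subseteq> L" if u: "u \<in> U" for u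
    unfolding L_def
  proof (rule conjg_image_generate_subset[OF _ gen])
    show "conjg u ` (\<Union>A\<in>\<K>. A \<inter> P) \<subseteq> (\<Union>A\<in>\<K>. A \<inter> P)"
    proof
      fix y assume "y \<in> conjg u ` (\<Union>A\<in>\<K>. A \<inter> P)"
      then obtain x A where "A \<in> \<K>" "x \<in> A" "x \<in> P" "y = conjg u x" by blast
      then show "y \<in> (\<Union>A\<in>\<K>. A \<inter> P)"
        using \<K>U[OF u] PU[OF u] by blast
    qed
  qed (use u in simp)
  have UL: "conjg u ` L = L" if "u \<in> U" for u
    by (rule conjg_image_eqI) (use that UL_sub in auto)
  \<comment> \<open>\<open>A\<close> is compact and \<open>P\<close> open, so finitely many cosets
    of \<open>P\<close> cover \<open>A\<close>. With representatives in \<open>A\<close>, the second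
    factor lies in \<open>A \<inter> P\<close>, hence in \<open>L\<close>.\<close>
  have cov: "covered A L" if A: "A \<in> \<K>" for A
  proof -
    interpret A: subgroup A G by (rule \<K>sub[OF A])
    obtain F where F: "finite F" "F \<subseteq> A" "A \<subseteq> F <#> P"
      using compactin_finite_cosets[OF \<K>comp[OF A] subP openP] by blast
    have "A \<subseteq> F <#> L"
    proof
      fix a assume a: "a \<in> A"
      then obtain f p where fp: "f \<in> F" "p \<in> P" "a = f \<otimes> p"
        using F(3) unfolding set_mult_def by blast
      then have "p = inv f \<otimes> a"
        using F(2) A.subset by (auto simp: subset_iff simp flip: m_assoc)
      then have "p \<in> A" using fp(1) a F(2) by auto
      then have "p \<in> L" using AL[OF A] fp(2) by blast
      with fp show "a \<in> F <#> L" unfolding set_mult_def by blast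
    qed
    then show ?thesis using F A.subset unfolding covered_def by blast
  qed
  \<comment> \<open>A finite \<open>L\<close> would cover the infinite \<open>K\<close> by finitely
    many translates.\<close>
  have "conjg \<one> ` K \<in> \<K>" by (rule \<K>I) (rule J(3))
  then have "covered K L" using cov Kcar by simp
  then obtain F where F: "finite F" "K \<subseteq> F <#> L" by (auto simp: covered_def)
  have infL: "infinite L"
  proof
    assume "finite L"
    then have "finite (F <#> L)" using F(1) by (auto simp: set_mult_def)
    then show False using F(2) K(2) finite_subset by blast
  qed
  have openL: "openin T (normalizer G L)"
  proof (rule openin_subgroupI[OF normalizer_imp_subgroup[OF L.subset] U(2) U.one_closed])
    show "U \<subseteq> normalizer G L"
      using UL by (auto simp: normalizer_eq[OF L.subset])
  qed
  have "U \<subseteq> virtual_normalizer L"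
    using UL covered_refl[OF L.subset] by (auto simp: virtual_normalizer_def)
  \<comment> \<open>As \<open>L\<close> lies in \<open>P\<close>, it normalises every member of the
    family, so the criterion for a factor applies to these conjugates.\<close>
  moreover have "conjg i ` K \<subseteq> virtual_normalizer L" if "i \<in> I" for i
  proof (rule virtual_normalizer_factor[OF _ subL])
    have A: "conjg i ` K \<in> \<K>" by (rule \<K>I) (use that J(4) in blast)
    show "subgroup (conjg i ` K) G" "covered (conjg i ` K) L"
      by (rule \<K>sub[OF A], rule cov[OF A])
    show "conjg l ` conjg i ` K = conjg i ` K" if "l \<in> L" for l
    proof -
      have "l \<in> P" using LP that by blast
      then show ?thesis using A by (simp add: P_def)
    qed
  qed
  \<comment> \<open>The commensurator is a subgroup and contains the chosen generators of G.\<close>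
  ultimately have "carrier G \<subseteq> virtual_normalizer L"
    unfolding I(3)[symmetric]
    by (intro generate_subgroup_incl virtual_normalizer_subgroup L.subset) blast
  then have "commensurated G L"
    by (rule commensurated_if_virtual_normalizer[OF subL])
  then show ?thesis
    using LH infL compL subL openL
    by (auto simp: infinite_compact_locally_normal_def locally_normal_def)
qed

end

theorem corollary4:
  fixes G :: "('a, 'b) monoid_scheme" and T :: "'a topology"
  assumes "script_S G T"
  shows "(\<forall>H. H \<lhd> G \<and> (\<exists>K \<subseteq> H. infinite_compact_locally_normal G T K) \<longrightarrow>
            (\<exists>K \<subseteq> H. infinite_compact_locally_normal G T K \<and> commensurated G K)) \<and>
         ((\<forall>N. N \<lhd> G \<and> N \<noteq> {\<one>\<^bsub>G\<^esub>} \<longrightarrow>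
              (\<exists>K \<subseteq> N. infinite_compact_locally_normal G T K)) \<longrightarrow>
          property_S1 G T)"
proof -
  interpret script_S G T by fact
  show ?thesis
    unfolding property_S1_def using commensurated_in_normal_subgroup by blast
qed

end
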